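(* Let $D$ be the set of nonzero binary cubics $P\in S^3((k^2)^* )$ having a double root (a root of multiplicity exactly two), and let $N_\mu=\{P\in S^3((k^2)^* ): P\ne 0\text{ and }\mu(P)\text{ is nonzero nilpotent}\}$. Then $D=N_\mu$.
   Context: $k$ is a field of characteristic different from $2$ and $3$; $x,y$ is the standard coordinate basis of $(k^2)^*$; $S^3((k^2)^* )=\{ax^3+3bx^2y+3cxy^2+dy^3: a,b,c,d\in k\}$ is the space of binary cubics. The moment map $\mu:S^3((k^2)^* )\to\mathfrak{sl}(2,k)$ is $$\mu(ax^3+3bx^2y+3cxy^2+dy^3)=\begin{pmatrix} ad-bc & 2(bd-c^2)\\ 2(b^2-ac) & -(ad-bc)\end{pmatrix}.$$ A binary cubic $P$ belongs to $D$ if and only if $P=\phi^2\xi$ for some linearly independent linear forms $\phi,\xi\in(k^2)^*$. *)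

theory Defs
  imports "HOL-Analysis.Analysis" "HOL-Computational_Algebra.Polynomial"
begin

section \<open>Binary forms\<close>

text \<open>
  The symmetric algebra of the dual of \<open>k\<^sup>2\<close> is the polynomial ring \<open>k[x,y]\<close>. It is
  represented as \<open>k[x][y]\<close>, so that the coefficient of \<open>x\<^sup>i y\<^sup>j\<close> in \<open>P\<close> is \<open>coeff (coeff P j) i\<close>.
\<close>

type_synonym 'a poly2 = "'a poly poly"

definition cst :: "'a::field \<Rightarrow> 'a poly2" where
  "cst c = [:[:c:]:]"

definition varx :: "'a::field poly2" where
  "varx = [:[:0, 1:]:]"

definition vary :: "'a::field poly2" where
  "vary = [:0, 1:]"

definition coeff2 :: "'a::field poly2 \<Rightarrow> nat \<Rightarrow> nat \<Rightarrow> 'a" where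
  "coeff2 P i j = coeff (coeff P j) i"

definition linear_form :: "'a::field \<Rightarrow> 'a \<Rightarrow> 'a poly2" where
  "linear_form p q = cst p * varx + cst q * vary"

definition linear_forms :: "'a::field poly2 set" where
  "linear_forms = {linear_form p q | p q. True}"

definition lin_indep :: "'a::field poly2 \<Rightarrow> 'a poly2 \<Rightarrow> bool" where
  "lin_indep \<phi> \<xi> \<longleftrightarrow> (\<forall>s t. cst s * \<phi> + cst t * \<xi> = 0 \<longrightarrow> s = 0 \<and> t = 0)"

definition binary_cubic :: "'a::field \<Rightarrow> 'a \<Rightarrow> 'a \<Rightarrow> 'a \<Rightarrow> 'a poly2" where
  "binary_cubic a b c d =
     cst a * varx ^ 3 + 3 * cst b * varx ^ 2 * vary + 3 * cst c * varx * vary ^ 2 + cst d * vary ^ 3"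

definition binary_cubics :: "'a::field poly2 set" where
  "binary_cubics = {binary_cubic a b c d | a b c d. True}"


section \<open>The moment map\<close>

text \<open>
  The parameters \<open>a, b, c, d\<close> are recovered from the coefficients of the cubic; the divisions
  by 3 make sense in characteristic different from 3 (see \<open>moment_map_binary_cubic\<close>).
  Only the values on \<open>binary_cubics\<close> are meaningful.
\<close>

definition moment_map :: "'a::field poly2 \<Rightarrow> 'a^2^2" where
  "moment_map P =
    (let a = coeff2 P 3 0; b = coeff2 P 2 1 / 3; c = coeff2 P 1 2 / 3; d = coeff2 P 0 3
     in vector [vector [a * d - b * c, 2 * (b * d - c\<^sup>2)],
                vector [2 * (b\<^sup>2 - a * c), - (a * d - b * c)]])"

definition nilpotent_matrix :: "'a::field^'n^'n \<Rightarrow> bool" where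
  "nilpotent_matrix A \<longleftrightarrow> (\<exists>m. (((**) A) ^^ m) (mat 1) = 0)"


section \<open>Double roots and the two sets of cubics\<close>

text \<open>
  A root of a binary form is a point \<open>[p\<^sub>1 : p\<^sub>2]\<close> of the projective line over \<open>k\<close>, given by
  a nonzero vector \<open>p\<close>. Its multiplicity is the exponent of the corresponding linear factor
  \<open>p\<^sub>2 x - p\<^sub>1 y\<close>.
\<close>

definition has_root_of_mult :: "'a::field poly2 \<Rightarrow> 'a^2 \<Rightarrow> nat \<Rightarrow> bool" where
  "has_root_of_mult P p m \<longleftrightarrow>
     linear_form (p $ 2) (- (p $ 1)) ^ m dvd P \<and> \<not> linear_form (p $ 2) (- (p $ 1)) ^ (m + 1) dvd P"

definition double_root_cubics :: "'a::field poly2 set" where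
  "double_root_cubics =
     {P \<in> binary_cubics. P \<noteq> 0 \<and> (\<exists>p. p \<noteq> 0 \<and> has_root_of_mult P p 2)}"

definition nilpotent_cubics :: "'a::field poly2 set" where
  "nilpotent_cubics =
     {P \<in> binary_cubics. P \<noteq> 0 \<and> moment_map P \<noteq> 0 \<and> nilpotent_matrix (moment_map P)}"


section \<open>Sanity checks\<close>

lemma CHAR_not_2_3:
  assumes "CHAR('a::field) \<noteq> 2" "CHAR('a) \<noteq> 3"
  shows "(2::'a) \<noteq> 0" "(3::'a) \<noteq> 0"
proof -
  have *: "(of_nat p :: 'a) \<noteq> 0" if "prime p" "CHAR('a) \<noteq> p" for p
    using that CHAR_not_1[where 'a='a] by (auto simp: of_nat_eq_0_iff_char_dvd prime_nat_iff)
  show "(2::'a) \<noteq> 0" "(3::'a) \<noteq> 0"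
    using *[of 2] *[of 3] assms by simp_all
qed

lemma coeff2_0 [simp]: "coeff2 0 i j = 0"
  by (simp add: coeff2_def)

lemma coeff2_add: "coeff2 (P + Q) i j = coeff2 P i j + coeff2 Q i j"
  by (simp add: coeff2_def)

lemma coeff2_cst_mult: "coeff2 (cst c * P) i j = c * coeff2 P i j"
  by (simp add: coeff2_def cst_def)

lemma coeff2_x_mult: "coeff2 (varx * P) i j = (if i = 0 then 0 else coeff2 P (i - 1) j)"
  by (cases i) (simp_all add: coeff2_def varx_def)

lemma coeff2_y_mult: "coeff2 (vary * P) i j = (if j = 0 then 0 else coeff2 P i (j - 1))"
  by (cases j) (simp_all add: coeff2_def vary_def)

lemma coeff2_1: "coeff2 1 i j = (if i = 0 \<and> j = 0 then 1 else 0)"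
  by (auto simp: coeff2_def coeff_pCons one_pCons split: nat.splits)

lemma poly2_eqI: "(\<And>i j. coeff2 P i j = coeff2 Q i j) \<Longrightarrow> P = Q"
  by (auto simp: coeff2_def intro!: poly_eqI)

lemma cst_1: "cst 1 = 1" and cst_mult: "cst (a * b) = cst a * cst b"
  and cst_minus: "cst (- a) = - cst a" and cst_add: "cst (a + b) = cst a + cst b"
  by (simp_all add: cst_def one_pCons)

lemma cst_3: "cst 3 = 3"
proof -
  have "cst (3 :: 'a) = cst (1 + 1 + 1)" by simp
  also have "\<dots> = 3" by (simp only: cst_add cst_1) simp
  finally show ?thesis .
qed

lemma coeff2_binary_cubic:
  "coeff2 (binary_cubic a b c d) i j =
     (if i = 3 \<and> j = 0 then a else if i = 2 \<and> j = 1 then 3 * b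
      else if i = 1 \<and> j = 2 then 3 * c else if i = 0 \<and> j = 3 then d else 0)"
proof -
  have "binary_cubic a b c d =
      cst a * (varx * (varx * (varx * 1))) + cst (3 * b) * (varx * (varx * (vary * 1)))
      + cst (3 * c) * (varx * (vary * (vary * 1))) + cst d * (vary * (vary * (vary * 1)))"
    by (simp add: binary_cubic_def cst_mult cst_3 power2_eq_square power3_eq_cube mult_ac)
  then show ?thesis
    by (simp only: coeff2_add coeff2_cst_mult coeff2_x_mult coeff2_y_mult coeff2_1)
       (auto simp: numeral_eq_Suc)
qed

lemma coeff2_linear_form_mult:
  "coeff2 (linear_form p q * Q) i j =
     p * (if i = 0 then 0 else coeff2 Q (i - 1) j) + q * (if j = 0 then 0 else coeff2 Q i (j - 1))"
  by (simp only: linear_form_def distrib_right mult.assoc coeff2_add coeff2_cst_mult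
                 coeff2_x_mult coeff2_y_mult)

lemma coeff2_linear_form:
  "coeff2 (linear_form p q) i j = (if i = 1 \<and> j = 0 then p else if i = 0 \<and> j = 1 then q else 0)"
  using coeff2_linear_form_mult[of p q 1 i j] by (auto simp: coeff2_1 split: if_splits)

lemma moment_map_binary_cubic:
  assumes "(3::'a::field) \<noteq> 0"
  shows "moment_map (binary_cubic a b c (d::'a)) =
    vector [vector [a * d - b * c, 2 * (b * d - c\<^sup>2)],
            vector [2 * (b\<^sup>2 - a * c), - (a * d - b * c)]]"
  using assms by (simp add: moment_map_def coeff2_binary_cubic Let_def)

lemma trace_moment_map: "trace (moment_map P) = 0"
  by (simp add: trace_def moment_map_def Let_def sum_2)

lemma linear_form_eq_0_iff: "linear_form p q = 0 \<longleftrightarrow> p = 0 \<and> q = 0"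
proof
  assume "linear_form p q = 0"
  then show "p = 0 \<and> q = 0"
    using coeff2_linear_form[of p q 1 0] coeff2_linear_form[of p q 0 1] by simp
qed (simp add: linear_form_def cst_def)

definition homogeneous :: "nat \<Rightarrow> 'a::field poly2 \<Rightarrow> bool" where
  "homogeneous n P \<longleftrightarrow> (\<forall>i j. i + j \<noteq> n \<longrightarrow> coeff2 P i j = 0)"

lemma homogeneous_quotient:
  assumes "homogeneous (Suc n) (linear_form p q * Q)" "p \<noteq> 0 \<or> q \<noteq> 0"
  shows "homogeneous n Q"
proof -
  have *: "p * (if i = 0 then 0 else coeff2 Q (i - 1) j)
           + q * (if j = 0 then 0 else coeff2 Q i (j - 1)) = 0" if "i + j \<noteq> Suc n" for i j
    using assms(1) that unfolding homogeneous_def coeff2_linear_form_mult by blast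
  have "coeff2 Q i j = 0" if "i + j \<noteq> n" for i j
  proof (cases "p = 0")
    case True
    then show ?thesis using *[of i "Suc j"] that assms(2) by simp
  next
    case False
    show ?thesis using that
    proof (induction j arbitrary: i)
      case 0
      then show ?case using *[of "Suc i" 0] False by simp
    next
      case (Suc j)
      then show ?case using *[of "Suc i" "Suc j"] Suc.IH[of "Suc i"] False by simp
    qed
  qed
  then show ?thesis by (simp add: homogeneous_def)
qed

lemma homogeneous_1D: "homogeneous 1 Q \<Longrightarrow> Q \<in> linear_forms"
proof -
  assume "homogeneous 1 Q"
  then have "Q = linear_form (coeff2 Q 1 0) (coeff2 Q 0 1)"
    by (intro poly2_eqI) (auto simp: homogeneous_def coeff2_linear_form)
  then show ?thesis unfolding linear_forms_def by blast
qed

lemma homogeneous_0D: "homogeneous 0 Q \<Longrightarrow> Q = cst (coeff2 Q 0 0)"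
  using coeff2_cst_mult[of "coeff2 Q 0 0" 1]
  by (intro poly2_eqI) (auto simp: homogeneous_def coeff2_1)

lemma lin_indep_linear_form:
  assumes "p \<noteq> 0 \<or> q \<noteq> 0" "\<xi> \<in> linear_forms"
  shows "lin_indep (linear_form p q) \<xi> \<longleftrightarrow> \<not> linear_form p q dvd \<xi>"
proof
  assume ind: "lin_indep (linear_form p q) \<xi>"
  show "\<not> linear_form p q dvd \<xi>"
  proof
    assume "linear_form p q dvd \<xi>"
    then obtain Q where Q: "\<xi> = linear_form p q * Q" by blast
    have "homogeneous (Suc 0) \<xi>"
      using assms(2) by (auto simp: linear_forms_def homogeneous_def coeff2_linear_form)
    with Q assms(1) obtain c where "Q = cst c"
      using homogeneous_quotient homogeneous_0D by metis
    then have "cst c * linear_form p q + cst (- 1) * \<xi> = 0"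
      using Q by (simp add: cst_minus cst_1)
    with ind show False by (force simp: lin_indep_def)
  qed
next
  assume nd: "\<not> linear_form p q dvd \<xi>"
  show "lin_indep (linear_form p q) \<xi>"
    unfolding lin_indep_def
  proof (intro allI impI)
    fix s t assume *: "cst s * linear_form p q + cst t * \<xi> = 0"
    have "t = 0"
    proof (rule ccontr)
      assume "t \<noteq> 0"
      then have "\<xi> = cst (inverse t) * (cst t * \<xi>)"
        by (simp add: mult.assoc[symmetric] cst_mult[symmetric] cst_1)
      also have "cst t * \<xi> = - (cst s * linear_form p q)"
        using * by (simp add: add_eq_0_iff)
      finally have "linear_form p q dvd \<xi>" by simp
      with nd show False ..
    qed
    with * have "cst s * linear_form p q = 0" by (simp add: cst_def)
    then have "s = 0" using assms(1) by (auto simp: linear_form_eq_0_iff cst_def)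
    with \<open>t = 0\<close> show "s = 0 \<and> t = 0" by simp
  qed
qed

text \<open>The factorisation description of cubics with a double root.\<close>

lemma double_root_cubics_iff:
  assumes "P \<in> binary_cubics"
  shows "P \<in> double_root_cubics \<longleftrightarrow>
    (\<exists>\<phi>\<in>linear_forms. \<exists>\<xi>\<in>linear_forms. lin_indep \<phi> \<xi> \<and> P = \<phi>\<^sup>2 * \<xi>)"
proof
  assume "P \<in> double_root_cubics"
  then obtain u where u: "u \<noteq> 0" "has_root_of_mult P u 2"
    unfolding double_root_cubics_def by blast
  define p q where "p = u $ 2" and "q = - (u $ 1)"
  have pq: "p \<noteq> 0 \<or> q \<noteq> 0"
    using u(1) by (auto simp: p_def q_def vec_eq_iff forall_2)
  let ?f = "linear_form p q"
  have d: "?f ^ 2 dvd P" "\<not> ?f ^ 3 dvd P"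
    using u(2) by (simp_all add: has_root_of_mult_def p_def q_def)
  then obtain Q where Q: "P = ?f\<^sup>2 * Q" by blast
  have "homogeneous (Suc (Suc (Suc 0))) P"
    using assms by (auto simp: binary_cubics_def homogeneous_def coeff2_binary_cubic)
  then have "homogeneous (Suc (Suc 0)) (?f * Q)"
    using homogeneous_quotient[OF _ pq] Q by (simp add: power2_eq_square mult.assoc)
  then have Ql: "Q \<in> linear_forms"
    using homogeneous_quotient[OF _ pq, of "Suc 0" Q] homogeneous_1D by simp
  have "\<not> ?f dvd Q"
    using d(2) by (auto simp: Q power2_eq_square power3_eq_cube mult_ac mult_dvd_mono)
  then show "\<exists>\<phi>\<in>linear_forms. \<exists>\<xi>\<in>linear_forms. lin_indep \<phi> \<xi> \<and> P = \<phi>\<^sup>2 * \<xi>"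
    using lin_indep_linear_form[OF pq Ql] Ql Q by (force simp: linear_forms_def)
next
  assume "\<exists>\<phi>\<in>linear_forms. \<exists>\<xi>\<in>linear_forms. lin_indep \<phi> \<xi> \<and> P = \<phi>\<^sup>2 * \<xi>"
  then obtain p q \<xi> where *: "\<xi> \<in> linear_forms" "lin_indep (linear_form p q) \<xi>"
      "P = (linear_form p q)\<^sup>2 * \<xi>"
    unfolding linear_forms_def by blast
  let ?f = "linear_form p q"
  have pq: "p \<noteq> 0 \<or> q \<noteq> 0"
  proof (rule ccontr)
    assume "\<not> ?thesis"
    then have "cst 1 * ?f + cst 0 * \<xi> = 0" by (simp add: linear_form_def cst_def)
    with *(2) show False by (force simp: lin_indep_def)
  qed
  have nz: "?f \<noteq> 0" using pq by (simp add: linear_form_eq_0_iff)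
  have "\<not> ?f dvd \<xi>" using lin_indep_linear_form[OF pq *(1)] *(2) by simp
  then have nd: "\<not> ?f ^ 3 dvd P"
    using nz by (simp add: *(3) power3_eq_cube power2_eq_square mult.assoc)
  define u :: "'a^2" where "u = vector [- q, p]"
  have "u \<noteq> 0" using pq by (auto simp: u_def vec_eq_iff forall_2)
  moreover have "has_root_of_mult P u 2"
    using nd by (simp add: has_root_of_mult_def u_def *(3))
  moreover have "P \<noteq> 0" using nd by auto
  ultimately show "P \<in> double_root_cubics"
    using assms unfolding double_root_cubics_def by blast
qed

end

theory Submission
  imports Defs
begin

text \<open>
  Both sides are governed by the Hessian covariant of a cubic. Writing the moment map of
  \<open>a x\<^sup>3 + 3 b x\<^sup>2 y + 3 c x y\<^sup>2 + d y\<^sup>3\<close> as the traceless matrix with rows \<open>(A, 2 B)\<close> and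
  \<open>(2 C, - A)\<close>, the Hessian is, up to a scalar, the quadratic form \<open>C x\<^sup>2 - A x y - B y\<^sup>2\<close>. Its
  discriminant \<open>A\<^sup>2 + 4 B C\<close> is minus the determinant of the matrix, so by Cayley-Hamilton the
  matrix is nilpotent iff the Hessian is a multiple of the square of a linear form.

  For \<open>P = \<phi>\<^sup>2 \<xi>\<close>, a direct computation shows that the Hessian is \<open>\<phi>\<^sup>2\<close> times \<open>\<Delta>\<^sup>2 / 9\<close>, where \<open>\<Delta>\<close>
  is the determinant of the pair \<open>(\<phi>, \<xi>)\<close> (\<open>moment_map_square_mult\<close>). Hence the moment map is
  always nilpotent on such products, and it is nonzero precisely when \<open>\<phi>\<close> and \<open>\<xi>\<close> are
  independent.

  Conversely, suppose that the Hessian is nonzero and has a double root. The syzygies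
  \<open>c C + b A = a B\<close> and \<open>d C + c A = b B\<close> say that both partial derivatives of \<open>P\<close> vanish at
  this root (\<open>singular_point_exists\<close>), so \<open>P\<close> is divisible by the square of the corresponding
  linear form \<open>\<phi>\<close> (\<open>factor_at_singular_point\<close>). The cofactor is independent of \<open>\<phi>\<close> by the
  formula above, since the moment map of \<open>P\<close> is not zero.
\<close>

section \<open>Nilpotency of traceless matrices of size two\<close>

lemma nilpotent_matrix_det:
  fixes M :: "'a::field^'n^'n"
  assumes "nilpotent_matrix M"
  shows "det M = 0"
proof -
  obtain m where m: "(((**) M) ^^ m) (mat 1) = 0"
    using assms unfolding nilpotent_matrix_def by blast
  have "det ((((**) M) ^^ m) (mat 1)) = det M ^ m"
    by (induction m) (simp_all add: det_mul)
  moreover have "det (0 :: 'a^'n^'n) = 0"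
    by (rule det_zero_row(2)) (simp add: row_def vec_eq_iff)
  ultimately show ?thesis
    using m by simp
qed

text \<open>The square of a traceless matrix of size two is minus its determinant, a scalar.\<close>

lemma nilpotent_traceless_iff:
  fixes \<alpha> \<beta> \<gamma> :: "'a::field"
  shows "nilpotent_matrix (vector [vector [\<alpha>, \<beta>], vector [\<gamma>, - \<alpha>]] :: 'a^2^2)
    \<longleftrightarrow> \<alpha>\<^sup>2 + \<beta> * \<gamma> = 0"
    (is "nilpotent_matrix ?M \<longleftrightarrow> _")
proof
  assume "nilpotent_matrix ?M"
  then have "- (\<alpha>\<^sup>2 + \<beta> * \<gamma>) = 0"
    using nilpotent_matrix_det[of ?M] by (simp add: det_2 power2_eq_square)
  then show "\<alpha>\<^sup>2 + \<beta> * \<gamma> = 0"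
    by (simp only: neg_equal_0_iff_equal)
next
  assume "\<alpha>\<^sup>2 + \<beta> * \<gamma> = 0"
  then have "?M ** ?M = 0"
    by (simp add: vec_eq_iff forall_2 matrix_matrix_mult_def sum_2 power2_eq_square
        algebra_simps add_eq_0_iff)
  then have "(((**) ?M) ^^ 2) (mat 1) = 0"
    by (simp add: numeral_2_eq_2)
  then show "nilpotent_matrix ?M"
    unfolding nilpotent_matrix_def by blast
qed

lemma traceless_eq_0_iff:
  fixes \<alpha> \<beta> \<gamma> :: "'a::field"
  shows "(vector [vector [\<alpha>, \<beta>], vector [\<gamma>, - \<alpha>]] :: 'a^2^2) = 0 \<longleftrightarrow> \<alpha> = 0 \<and> \<beta> = 0 \<and> \<gamma> = 0"
  by (auto simp: vec_eq_iff forall_2)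

section \<open>Products of a square and a linear form\<close>

lemma square_mult_eq_binary_cubic:
  fixes p q r s :: "'a::field"
  assumes "(3::'a) \<noteq> 0"
  shows "(linear_form p q)\<^sup>2 * linear_form r s =
    binary_cubic (p\<^sup>2 * r) ((p\<^sup>2 * s + 2 * p * q * r) / 3) ((2 * p * q * s + q\<^sup>2 * r) / 3) (q\<^sup>2 * s)"
proof (rule poly2_eqI)
  fix i j
  have "(linear_form p q)\<^sup>2 * linear_form r s = linear_form p q * (linear_form p q * linear_form r s)"
    by (simp add: power2_eq_square mult.assoc)
  then show "coeff2 ((linear_form p q)\<^sup>2 * linear_form r s) i j = coeff2 (binary_cubic (p\<^sup>2 * r)
      ((p\<^sup>2 * s + 2 * p * q * r) / 3) ((2 * p * q * s + q\<^sup>2 * r) / 3) (q\<^sup>2 * s)) i j"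
    using assms
    by (simp only: coeff2_linear_form_mult coeff2_linear_form coeff2_binary_cubic)
      (auto simp: numeral_eq_Suc power2_eq_square algebra_simps split: if_splits)
qed

text \<open>
  Equivariance predicts the shape of this formula: \<open>\<phi>\<^sup>2\<close> corresponds to a nilpotent matrix whose
  kernel is the root of \<open>\<phi>\<close>, and the remaining factor is an invariant of the pair
  \<open>(\<phi>, \<xi>)\<close> of degree two in \<open>\<xi>\<close>.
\<close>

lemma moment_map_square_mult:
  fixes p q r s :: "'a::field"
  assumes "(3::'a) \<noteq> 0"
  defines "t \<equiv> 2 * ((p * s - q * r) / 3)\<^sup>2"
  shows "moment_map ((linear_form p q)\<^sup>2 * linear_form r s) =
    vector [vector [- (t * p * q), - (t * q\<^sup>2)], vector [t * p\<^sup>2, - (- (t * p * q))]]"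
proof -
  define b c where "b = (p\<^sup>2 * s + 2 * p * q * r) / 3" and "c = (2 * p * q * s + q\<^sup>2 * r) / 3"
  define e where "e = (p * s - q * r) / 3"
  have eqs: "3 * b = p\<^sup>2 * s + 2 * p * q * r" "3 * c = 2 * p * q * s + q\<^sup>2 * r"
      "3 * e = p * s - q * r"
    using assms(1) by (simp_all add: b_def c_def e_def)
  have nine: "x = y" if "(3 * 3) * x = (3 * 3) * y" for x y :: 'a
    using that assms(1) by (simp only: mult_cancel_left mult_eq_0_iff) simp
  have "(3 * 3) * (p\<^sup>2 * r * (q\<^sup>2 * s) - b * c) =
      (3 * 3) * (p\<^sup>2 * r * (q\<^sup>2 * s)) - (3 * b) * (3 * c)"
    by algebra
  also have "\<dots> = - (2 * (3 * e)\<^sup>2 * p * q)"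
    unfolding eqs by algebra
  also have "\<dots> = (3 * 3) * - (2 * e\<^sup>2 * p * q)"
    by algebra
  finally have "p\<^sup>2 * r * (q\<^sup>2 * s) - b * c = - (2 * e\<^sup>2 * p * q)"
    by (rule nine)
  moreover have "2 * (b * (q\<^sup>2 * s) - c\<^sup>2) = - (2 * e\<^sup>2 * q\<^sup>2)"
  proof (rule nine)
    have "(3 * 3) * (2 * (b * (q\<^sup>2 * s) - c\<^sup>2)) = 2 * (3 * (3 * b) * (q\<^sup>2 * s) - (3 * c)\<^sup>2)"
      by algebra
    also have "\<dots> = - (2 * (3 * e)\<^sup>2 * q\<^sup>2)"
      unfolding eqs by algebra
    also have "\<dots> = (3 * 3) * - (2 * e\<^sup>2 * q\<^sup>2)"
      by algebra
    finally show "(3 * 3) * (2 * (b * (q\<^sup>2 * s) - c\<^sup>2)) = (3 * 3) * - (2 * e\<^sup>2 * q\<^sup>2)" .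
  qed
  moreover have "2 * (b\<^sup>2 - p\<^sup>2 * r * c) = 2 * e\<^sup>2 * p\<^sup>2"
  proof (rule nine)
    have "(3 * 3) * (2 * (b\<^sup>2 - p\<^sup>2 * r * c)) = 2 * ((3 * b)\<^sup>2 - 3 * (p\<^sup>2 * r) * (3 * c))"
      by algebra
    also have "\<dots> = 2 * (3 * e)\<^sup>2 * p\<^sup>2"
      unfolding eqs by algebra
    also have "\<dots> = (3 * 3) * (2 * e\<^sup>2 * p\<^sup>2)"
      by algebra
    finally show "(3 * 3) * (2 * (b\<^sup>2 - p\<^sup>2 * r * c)) = (3 * 3) * (2 * e\<^sup>2 * p\<^sup>2)" .
  qed
  ultimately show ?thesis
    unfolding square_mult_eq_binary_cubic[OF assms(1)] moment_map_binary_cubic[OF assms(1)]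
      b_def[symmetric] c_def[symmetric] t_def e_def[symmetric]
    by simp
qed

lemma nilpotent_moment_map_square_mult:
  fixes p q r s :: "'a::field"
  assumes "(3::'a) \<noteq> 0"
  shows "nilpotent_matrix (moment_map ((linear_form p q)\<^sup>2 * linear_form r s))"
  unfolding moment_map_square_mult[OF assms] nilpotent_traceless_iff
  by (simp add: power2_eq_square)

lemma cst_mult_linear_form: "cst u * linear_form p q = linear_form (u * p) (u * q)"
  by (simp add: linear_form_def cst_mult distrib_left mult.assoc)

lemma linear_form_add: "linear_form p q + linear_form r s = linear_form (p + r) (q + s)"
  by (simp add: linear_form_def cst_add distrib_right)

lemma lin_indep_iff_det:
  "lin_indep (linear_form p q) (linear_form r s) \<longleftrightarrow> p * s - q * r \<noteq> 0"
proof -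
  have "lin_indep (linear_form p q) (linear_form r s) \<longleftrightarrow>
      (\<forall>u v. u * p + v * r = 0 \<and> u * q + v * s = 0 \<longrightarrow> u = 0 \<and> v = 0)"
    by (simp add: lin_indep_def cst_mult_linear_form linear_form_add linear_form_eq_0_iff)
  also have "\<dots> \<longleftrightarrow> p * s - q * r \<noteq> 0"
  proof
    assume indep: "\<forall>u v. u * p + v * r = 0 \<and> u * q + v * s = 0 \<longrightarrow> u = 0 \<and> v = 0"
    show "p * s - q * r \<noteq> 0"
    proof
      assume "p * s - q * r = 0"
      \<comment> \<open>The rows of the adjugate matrix are then relations; if both are trivial, the two forms
        vanish, and any coefficients give a relation.\<close>
      then have "s = 0 \<and> - q = 0" and "- r = 0 \<and> p = 0"
        using indep[rule_format, of s "- q"] indep[rule_format, of "- r" p]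
        by (simp_all add: algebra_simps)
      then show False
        using indep[rule_format, of 1 0] by simp
    qed
  next
    assume det: "p * s - q * r \<noteq> 0"
    show "\<forall>u v. u * p + v * r = 0 \<and> u * q + v * s = 0 \<longrightarrow> u = 0 \<and> v = 0"
    proof (intro allI impI)
      fix u v
      assume "u * p + v * r = 0 \<and> u * q + v * s = 0"
      then have "(p * s - q * r) * u = 0" "(p * s - q * r) * v = 0"
        by algebra+
      with det show "u = 0 \<and> v = 0" by simp
    qed
  qed
  finally show ?thesis .
qed

lemma moment_map_square_mult_eq_0_iff:
  fixes p q r s :: "'a::field"
  assumes "(2::'a) \<noteq> 0" "(3::'a) \<noteq> 0"
  shows "moment_map ((linear_form p q)\<^sup>2 * linear_form r s) = 0 \<longleftrightarrow>
    \<not> lin_indep (linear_form p q) (linear_form r s)"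
  unfolding moment_map_square_mult[OF assms(2)] traceless_eq_0_iff lin_indep_iff_det
  using assms by auto

section \<open>Singular points of a cubic\<close>

text \<open>
  The two hypotheses are the vanishing of the partial derivatives, divided by 3, at the point
  \<open>(- q, p)\<close>, the root of the linear form \<open>p x + q y\<close>. The cofactor is read off from the two
  outermost coefficients at the end where the linear form has a nonzero coefficient.
\<close>

lemma factor_at_singular_point:
  fixes a b c d p q :: "'a::field"
  assumes "(3::'a) \<noteq> 0" and "p \<noteq> 0 \<or> q \<noteq> 0"
    and dx: "a * q\<^sup>2 - 2 * b * p * q + c * p\<^sup>2 = 0"
    and dy: "b * q\<^sup>2 - 2 * c * p * q + d * p\<^sup>2 = 0"
  shows "\<exists>r s. binary_cubic a b c d = (linear_form p q)\<^sup>2 * linear_form r s"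
proof -
  have "\<exists>r s. a = p\<^sup>2 * r \<and> 3 * b = p\<^sup>2 * s + 2 * p * q * r \<and>
      3 * c = 2 * p * q * s + q\<^sup>2 * r \<and> d = q\<^sup>2 * s"
  proof (cases "p = 0")
    case True
    then have "q \<noteq> 0" using assms(2) by simp
    then show ?thesis
      using dx dy True by (intro exI[of _ "3 * c / q\<^sup>2"] exI[of _ "d / q\<^sup>2"]) simp
  next
    case False
    define r s where "r = a / p\<^sup>2" and "s = (3 * b - 2 * p * q * r) / p\<^sup>2"
    have a: "a = p\<^sup>2 * r" and b: "3 * b = p\<^sup>2 * s + 2 * p * q * r"
      using False by (simp_all add: r_def s_def)
    have "p\<^sup>2 * (3 * c) = p\<^sup>2 * (2 * p * q * s + q\<^sup>2 * r)"
      using a b dx by algebra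
    then have c: "3 * c = 2 * p * q * s + q\<^sup>2 * r"
      using False by simp
    have "3 * p\<^sup>2 * d = 3 * p\<^sup>2 * (q\<^sup>2 * s)"
      using b c dy by algebra
    then have "d = q\<^sup>2 * s"
      using False assms(1) by simp
    with a b c show ?thesis by blast
  qed
  then obtain r s where *: "a = p\<^sup>2 * r" "3 * b = p\<^sup>2 * s + 2 * p * q * r"
      "3 * c = 2 * p * q * s + q\<^sup>2 * r" "d = q\<^sup>2 * s"
    by blast
  have "b = (p\<^sup>2 * s + 2 * p * q * r) / 3" "c = (2 * p * q * s + q\<^sup>2 * r) / 3"
    using assms(1) by (simp_all flip: *(2,3))
  with * show ?thesis
    using square_mult_eq_binary_cubic[OF assms(1), of p q r s] by metis
qed

text \<open>
  When the discriminant of the Hessian \<open>C x\<^sup>2 - A x y - B y\<^sup>2\<close> vanishes, \<open>4 C\<close> times the Hessian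
  is \<open>(2 C x - A y)\<^sup>2\<close>, which gives the singular point if \<open>C \<noteq> 0\<close>. If \<open>C = 0\<close>, the Hessian is a
  multiple of \<open>y\<^sup>2\<close>.
\<close>

lemma singular_point_exists:
  fixes a b c d :: "'a::field"
  defines "A \<equiv> a * d - b * c" and "B \<equiv> b * d - c\<^sup>2" and "C \<equiv> b\<^sup>2 - a * c"
  assumes "(2::'a) \<noteq> 0" and disc: "A\<^sup>2 + 4 * B * C = 0"
    and nz: "A \<noteq> 0 \<or> B \<noteq> 0 \<or> C \<noteq> 0"
  shows "\<exists>p q. (p \<noteq> 0 \<or> q \<noteq> 0) \<and> a * q\<^sup>2 - 2 * b * p * q + c * p\<^sup>2 = 0 \<and>
    b * q\<^sup>2 - 2 * c * p * q + d * p\<^sup>2 = 0"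
proof -
  have syz: "c * C + b * A = a * B" "d * C + c * A = b * B"
    unfolding A_def B_def C_def by algebra+
  show ?thesis
  proof (cases "C = 0")
    case True
    then have "A = 0" using disc by simp
    with True nz syz have "a = 0" "b = 0" by simp_all
    then show ?thesis
      by (intro exI[of _ 0] exI[of _ 1]) simp
  next
    case False
    have "a * (- A)\<^sup>2 - 2 * b * (2 * C) * (- A) + c * (2 * C)\<^sup>2 = 0"
      "b * (- A)\<^sup>2 - 2 * c * (2 * C) * (- A) + d * (2 * C)\<^sup>2 = 0"
      using syz disc by algebra+
    moreover have "2 * C \<noteq> 0" using False assms(4) by simp
    ultimately show ?thesis by blast
  qed
qed

section \<open>Double roots and nilpotent moment map\<close>

theorem theorem3p10:
  assumes "CHAR('a::field) \<noteq> 2" and "CHAR('a) \<noteq> 3"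
  shows "(double_root_cubics :: 'a poly2 set) = nilpotent_cubics"
proof (rule set_eqI)
  fix P :: "'a poly2"
  have two: "(2::'a) \<noteq> 0" and three: "(3::'a) \<noteq> 0"
    using CHAR_not_2_3 assms by blast+
  show "P \<in> double_root_cubics \<longleftrightarrow> P \<in> nilpotent_cubics"
  proof
    assume P: "P \<in> double_root_cubics"
    then have cubic: "P \<in> binary_cubics" "P \<noteq> 0"
      by (simp_all add: double_root_cubics_def)
    then obtain p q r s where "lin_indep (linear_form p q) (linear_form r s)"
        "P = (linear_form p q)\<^sup>2 * linear_form r s"
      using P double_root_cubics_iff unfolding linear_forms_def by blast
    then show "P \<in> nilpotent_cubics"
      using cubic nilpotent_moment_map_square_mult[OF three, of p q r s]
        moment_map_square_mult_eq_0_iff[OF two three, of p q r s]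
      by (simp add: nilpotent_cubics_def)
  next
    assume "P \<in> nilpotent_cubics"
    then have cubic: "P \<in> binary_cubics" and nz: "moment_map P \<noteq> 0"
        and nil: "nilpotent_matrix (moment_map P)"
      by (simp_all add: nilpotent_cubics_def)
    obtain a b c d where P: "P = binary_cubic a b c d"
      using cubic unfolding binary_cubics_def by blast
    define A B C where "A = a * d - b * c" and "B = b * d - c\<^sup>2" and "C = b\<^sup>2 - a * c"
    have mu: "moment_map P = vector [vector [A, 2 * B], vector [2 * C, - A]]"
      unfolding P A_def B_def C_def by (rule moment_map_binary_cubic[OF three])
    have "A\<^sup>2 + 4 * B * C = 0"
      using nil unfolding mu nilpotent_traceless_iff by algebra
    moreover have "A \<noteq> 0 \<or> B \<noteq> 0 \<or> C \<noteq> 0"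
      using nz unfolding mu traceless_eq_0_iff by auto
    ultimately obtain p q where "p \<noteq> 0 \<or> q \<noteq> 0"
        "a * q\<^sup>2 - 2 * b * p * q + c * p\<^sup>2 = 0" "b * q\<^sup>2 - 2 * c * p * q + d * p\<^sup>2 = 0"
      using singular_point_exists[OF two, of a d b c] unfolding A_def B_def C_def by blast
    then obtain r s where fac: "P = (linear_form p q)\<^sup>2 * linear_form r s"
      using factor_at_singular_point[OF three] unfolding P by blast
    then have "lin_indep (linear_form p q) (linear_form r s)"
      using nz moment_map_square_mult_eq_0_iff[OF two three, of p q r s] by simp
    then show "P \<in> double_root_cubics"
      using fac unfolding double_root_cubics_iff[OF cubic] linear_forms_def by blast
  qed
qed

end
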